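(* Let $n\ge 1$ be an integer, let $G$ be the $(2n+1)$-dimensional solvable matrix Lie group equipped with the left-invariant Riemannian metric $g$ described in the context (for some constant $\lambda\neq 0$), and let $\tau_G=(T_G,\pi_G,G,\mathbb{R}^{2n+1})$ be its tangent bundle. Consider homogeneous (geodesic) vectors in the fiber $T_eG\cong\mathbb{R}^{2n+1}$ of $\tau_G$ over the origin $e$, with orthogonality taken with respect to $g_e$. Then: (i) There are $2n+1$ linearly independent homogeneous (geodesic) vectors in the fiber of $\tau_G$. (ii) If $n+1$ is odd, the maximum number of mutually orthogonal homogeneous (geodesic) vectors in the fiber of $\tau_G$ is $n+1$. (iii) If $n+1$ is even and not divisible by $4$, the maximum number of mutually orthogonal homogeneous (geodesic) vectors in the fiber of $\tau_G$ is $n+2$. (iv) If $n+1$ is even and divisible by $4$ and there exists a Hadamard matrix of order $n+1$, the maximum number of mutually orthogonal homogeneous (geodesic) vectors in the fiber of $\tau_G$ is $2n+1$.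
   Context: The group $G$: all $(n+2)\times(n+2)$ real matrices of the form $$\begin{pmatrix} e^{z_0} & 0 & \cdots & 0 & x_0\\ 0 & e^{z_1} & \cdots & 0 & x_1\\ \vdots & \vdots & \ddots & \vdots & \vdots\\ 0 & 0 & \cdots & e^{z_n} & x_n\\ 0 & 0 & \cdots & 0 & 1\end{pmatrix},$$ where $(x_0,x_1,\dots,x_n,z_1,\dots,z_n)\in\mathbb{R}^{2n+1}$ and $z_0=-(z_1+\cdots+z_n)$. These parameters are global coordinates on $G$; the origin (identity) $e$ is the point $(0,\dots,0)$. $G$ carries the left-invariant Riemannian metric $$g=\sum_{i=0}^n e^{-2z_i}\,dx_i^2+\lambda^2\sum_{0\le k\le j\le n}dz_k\,dz_j,\qquad dz_0=-(dz_1+\cdots+dz_n),$$ with $\lambda\ne 0$ a constant. $G$ acts on itself by left translations, so $(G,g)$ is a homogeneous Riemannian manifold with trivial isotropy group $K=\{e\}$ in $G$. Let $\mathcal{G}$ be the Lie algebra of $G$, identified with $T_eG\cong\mathbb{R}^{2n+1}$. A nonzero vector $X\in\mathcal{G}$ is called a homogeneous vector (or geodesic vector) if the curve $\gamma(t)=\exp(tX)\cdot e=\exp(tX)$ is a geodesic of $(G,g)$. A Hadamard matrix of order $k$ is a $k\times k$ matrix $A$ with all entries equal to $\pm1$ such that $AA^t=kI_k$, where $I_k$ is the identity matrix. *)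

theory Defs
  imports "HOL-Analysis.Analysis" "HOL-Library.Option_ord"
begin

section \<open>Geodesics of a metric given in global coordinates\<close>

text \<open>
  A metric on \<open>\<real>\<^sup>m\<close> assigns to every point \<open>p\<close> a bilinear form \<open>g p\<close> on the tangent space
  at \<open>p\<close>, which is identified with \<open>\<real>\<^sup>m\<close> by the coordinate frame \<open>axis i 1\<close>.
\<close>

type_synonym 'm metric = "(real, 'm) vec \<Rightarrow> (real, 'm) vec \<Rightarrow> (real, 'm) vec \<Rightarrow> real"

definition gram :: "'m::finite metric \<Rightarrow> real^'m \<Rightarrow> real^'m^'m" where
  "gram g p = (\<chi> i j. g p (axis i 1) (axis j 1))"

definition dgram :: "'m::finite metric \<Rightarrow> real^'m \<Rightarrow> 'm \<Rightarrow> 'm \<Rightarrow> 'm \<Rightarrow> real" where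
  "dgram g p l i j = deriv (\<lambda>s. gram g (p + s *\<^sub>R axis l 1) $ i $ j) 0"

definition christoffel :: "'m::finite metric \<Rightarrow> real^'m \<Rightarrow> 'm \<Rightarrow> 'm \<Rightarrow> 'm \<Rightarrow> real" where
  "christoffel g p k i j =
     (\<Sum>l\<in>UNIV. matrix_inv (gram g p) $ k $ l *
        (dgram g p i j l + dgram g p j i l - dgram g p l i j)) / 2"

definition geodesic :: "'m::finite metric \<Rightarrow> (real \<Rightarrow> real^'m) \<Rightarrow> bool" where
  "geodesic g \<gamma> \<longleftrightarrow> (\<exists>\<gamma>' \<gamma>''. \<forall>t.
     (\<gamma> has_vector_derivative \<gamma>' t) (at t) \<and>
     (\<gamma>' has_vector_derivative \<gamma>'' t) (at t) \<and>
     (\<forall>k. \<gamma>'' t $ k +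
        (\<Sum>i\<in>UNIV. \<Sum>j\<in>UNIV. christoffel g (\<gamma> t) k i j * \<gamma>' t $ i * \<gamma>' t $ j) = 0))"


section \<open>The matrix exponential\<close>

text \<open>
  The operation \<open>*\<close> on \<open>real^'m^'m\<close> is componentwise, so the library's \<open>exp\<close> is not the
  exponential of matrices.
\<close>

definition mexp :: "real^'m^'m \<Rightarrow> real^'m^'m" where
  "mexp A = (\<Sum>k. (1 / fact k) *\<^sub>R (((**) A) ^^ k) (mat 1))"


section \<open>The group\<close>

text \<open>
  The indices \<open>1, \<dots>, n\<close> are the elements of a finite linearly ordered type \<open>'n\<close>, so \<open>n = CARD('n)\<close>;
  the indices \<open>0, 1, \<dots>, n\<close> are the elements of \<open>'n option\<close> with \<open>None\<close> (the least element)
  for \<open>0\<close>. The component at \<open>Inl i\<close> is \<open>x\<^sub>i\<close>, and the component at \<open>Inr j\<close> is \<open>z\<^sub>j\<close>.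
\<close>

type_synonym 'n coords = "(real, 'n option + 'n) vec"

text \<open>The same function gives the differentials \<open>dz\<^sub>0, \<dots>, dz\<^sub>n\<close>, because it is linear.\<close>

definition zc :: "'n::finite coords \<Rightarrow> 'n option \<Rightarrow> real" where
  "zc p i = (case i of None \<Rightarrow> - (\<Sum>j\<in>UNIV. p $ Inr j) | Some j \<Rightarrow> p $ Inr j)"

text \<open>Rows and columns \<open>0, \<dots>, n\<close> are \<open>Inl i\<close>; the last row and column is \<open>Inr ()\<close>.\<close>

definition group_elem :: "'n::finite coords \<Rightarrow> real^('n option + unit)^('n option + unit)" where
  "group_elem p = (\<chi> r c. case r of
       Inl i \<Rightarrow> (case c of Inl j \<Rightarrow> (if i = j then exp (zc p i) else 0) | Inr _ \<Rightarrow> p $ Inl i)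
     | Inr _ \<Rightarrow> (case c of Inl _ \<Rightarrow> 0 | Inr _ \<Rightarrow> 1))"

text \<open>
  The element of the matrix Lie algebra that corresponds to a vector of \<open>T\<^sub>eG\<close>, i.e. the
  derivative of \<open>group_elem\<close> at the origin (see \<open>group_elem_has_derivative\<close>).
\<close>

definition algebra_elem :: "'n::finite coords \<Rightarrow> real^('n option + unit)^('n option + unit)" where
  "algebra_elem X = (\<chi> r c. case r of
       Inl i \<Rightarrow> (case c of Inl j \<Rightarrow> (if i = j then zc X i else 0) | Inr _ \<Rightarrow> X $ Inl i)
     | Inr _ \<Rightarrow> 0)"

lemma zc_has_derivative:
  "((\<lambda>p. zc p i) has_derivative (\<lambda>X. zc X i)) F"
proof (cases i)
  case None
  have "((\<lambda>p :: 'a coords. - (\<Sum>j\<in>UNIV. p $ Inr j)) has_derivative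
      (\<lambda>X. - (\<Sum>j\<in>UNIV. X $ Inr j))) F"
    by (intro has_derivative_minus has_derivative_sum bounded_linear_imp_has_derivative
        bounded_linear_vec_nth)
  with None show ?thesis by (simp add: zc_def)
next
  case (Some j)
  then show ?thesis
    by (simp add: zc_def bounded_linear_imp_has_derivative bounded_linear_vec_nth)
qed

lemma group_elem_has_derivative:
  "(group_elem has_derivative algebra_elem) (at (0 :: 'n::finite coords))"
proof -
  have z0: "zc (0 :: 'n coords) i = 0" for i
    by (simp add: zc_def split: option.split)
  have e: "((\<lambda>p. exp (zc p i)) has_derivative (\<lambda>X. zc X i)) (at (0 :: 'n coords))" for i
    using has_derivative_exp[OF zc_has_derivative[of i "at (0 :: 'n coords)"]] by (simp add: z0)
  have d: "((\<lambda>p. if i = j then exp (zc p i) else 0) has_derivative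
      (\<lambda>X. if i = j then zc X i else 0)) (at (0 :: 'n coords))" for i j
    by (cases "i = j") (simp_all add: e)
  have c: "((\<lambda>p. group_elem p $ r $ c) has_derivative (\<lambda>X. algebra_elem X $ r $ c))
      (at (0 :: 'n coords))" for r c
    by (cases r; cases c)
      (auto simp: group_elem_def algebra_elem_def d bounded_linear_imp_has_derivative
        bounded_linear_vec_nth)
  show ?thesis
    unfolding has_derivative_componentwise_within[of group_elem]
    by (auto simp: Basis_vec_def inner_axis c)
qed

text \<open>As usual, \<open>dz\<^sub>k dz\<^sub>j\<close> is the symmetric product \<open>(dz\<^sub>k \<otimes> dz\<^sub>j + dz\<^sub>j \<otimes> dz\<^sub>k) / 2\<close>.\<close>

definition group_metric :: "real \<Rightarrow> ('n::{finite,linorder} option + 'n) metric" where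
  "group_metric lam p u v =
     (\<Sum>i\<in>UNIV. exp (- 2 * zc p i) * u $ Inl i * v $ Inl i) +
     lam\<^sup>2 * (\<Sum>j\<in>UNIV. \<Sum>k\<in>{..j}. (zc u k * zc v j + zc u j * zc v k) / 2)"


section \<open>Homogeneous vectors\<close>

definition homogeneous_vector :: "real \<Rightarrow> 'n::{finite,linorder} coords \<Rightarrow> bool" where
  "homogeneous_vector lam X \<longleftrightarrow> X \<noteq> 0 \<and>
     (\<exists>\<gamma>. (\<forall>t. group_elem (\<gamma> t) = mexp (t *\<^sub>R algebra_elem X)) \<and>
          geodesic (group_metric lam) \<gamma>)"

definition orthogonal_homogeneous_sets :: "real \<Rightarrow> 'n::{finite,linorder} coords set set" where
  "orthogonal_homogeneous_sets lam =
     {S. (\<forall>X\<in>S. homogeneous_vector lam X) \<and> pairwise (\<lambda>X Y. group_metric lam 0 X Y = 0) S}"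

definition max_card_in :: "'a set set \<Rightarrow> nat \<Rightarrow> bool" where
  "max_card_in \<F> N \<longleftrightarrow>
     (\<exists>S\<in>\<F>. finite S \<and> card S = N) \<and> (\<forall>S\<in>\<F>. finite S \<and> card S \<le> N)"


section \<open>Hadamard matrices\<close>

definition hadamard_matrix :: "real^'m^'m \<Rightarrow> bool" where
  "hadamard_matrix A \<longleftrightarrow>
     (\<forall>i j. A $ i $ j = 1 \<or> A $ i $ j = - 1) \<and>
     A ** transpose A = of_nat CARD('m) *\<^sub>R mat 1"

end

theory Submission
  imports Defs
begin

text \<open>
  Since \<open>dz\<^sub>0 + \<dots> + dz\<^sub>n = 0\<close>, the quadratic form \<open>\<Sum>\<^sub>k\<^sub>\<le>\<^sub>j dz\<^sub>k dz\<^sub>j\<close> is half of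
  \<open>\<Sum>\<^sub>i dz\<^sub>i\<^sup>2\<close>, so the metric is diagonal in the redundant coframe \<open>dx\<^sub>0, \<dots>, dx\<^sub>n, dz\<^sub>0, \<dots>, dz\<^sub>n\<close>
  (\<open>group_metric_diag\<close>). The one-parameter subgroups are explicit (\<open>mexp_algebra_elem\<close>), and the
  geodesic equation along the one generated by \<open>X = (a, b)\<close> reduces to conditions that do not depend
  on time: \<open>a\<^sub>i b\<^sub>i = 0\<close> for all \<open>i = 0, \<dots>, n\<close>, and all \<open>a\<^sub>i\<^sup>2\<close> are equal
  (\<open>homogeneous_vector_iff\<close>). So a homogeneous vector is either a nonzero vector
  \<open>(0, b)\<close>, or a nonzero multiple of \<open>(\<plusminus>1, \<dots>, \<plusminus>1, 0)\<close>.

  These two kinds of vectors together span the tangent space, which gives part (i)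
  (\<open>homogeneous_vectors_span\<close>). They are orthogonal to each other; the first kind fills a subspace
  of dimension \<open>n\<close>, which has an orthogonal basis, and on the second kind the metric is the standard
  inner product of \<open>\<real>\<^sup>n\<^sup>+\<^sup>1\<close>. Hence the maximum is \<open>n + k\<close>, where \<open>k\<close> is the greatest number of
  mutually orthogonal sign vectors in \<open>\<real>\<^sup>n\<^sup>+\<^sup>1\<close> (\<open>max_card_orthogonal_homogeneous\<close>). Counting agreeing
  signs shows that two orthogonal sign vectors exist only in even dimension and three only in
  dimension divisible by \<open>4\<close>, so \<open>k = 1\<close> and \<open>k = 2\<close> in parts (ii) and (iii); the rows of a
  Hadamard matrix give \<open>k = n + 1\<close> in part (iv).
\<close>

section \<open>Geodesics\<close>

text \<open>
  The Christoffel symbols of the first kind, contracted twice with \<open>v\<close>. Working with them avoids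
  the inverse of the Gram matrix.
\<close>

definition first_kind :: "'m::finite metric \<Rightarrow> real^'m \<Rightarrow> real^'m \<Rightarrow> real^'m" where
  "first_kind g p v = (\<chi> l. \<Sum>i\<in>UNIV. \<Sum>j\<in>UNIV.
     (dgram g p i j l + dgram g p j i l - dgram g p l i j) / 2 * v $ i * v $ j)"

lemma christoffel_quadratic:
  "(\<Sum>i\<in>UNIV. \<Sum>j\<in>UNIV. christoffel g p k i j * v $ i * v $ j) =
     (matrix_inv (gram g p) *v first_kind g p v) $ k"
proof -
  let ?M = "matrix_inv (gram g p)"
  let ?c = "\<lambda>l i j. dgram g p i j l + dgram g p j i l - dgram g p l i j"
  have "(\<Sum>i\<in>UNIV. \<Sum>j\<in>UNIV. christoffel g p k i j * v $ i * v $ j) =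
      (\<Sum>i\<in>UNIV. \<Sum>j\<in>UNIV. \<Sum>l\<in>UNIV. ?M $ k $ l * (?c l i j / 2 * v $ i * v $ j))"
    by (simp add: christoffel_def sum_distrib_right sum_divide_distrib mult.assoc)
  also have "\<dots> = (\<Sum>i\<in>UNIV. \<Sum>l\<in>UNIV. \<Sum>j\<in>UNIV. ?M $ k $ l * (?c l i j / 2 * v $ i * v $ j))"
    by (intro sum.cong refl sum.swap)
  also have "\<dots> = (\<Sum>l\<in>UNIV. \<Sum>i\<in>UNIV. \<Sum>j\<in>UNIV. ?M $ k $ l * (?c l i j / 2 * v $ i * v $ j))"
    by (rule sum.swap)
  finally show ?thesis
    by (simp add: matrix_vector_mult_def first_kind_def sum_distrib_left)
qed

lemma matrix_inv_mult:
  fixes A :: "real^'m^'m"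
  assumes "invertible A"
  shows "A ** matrix_inv A = mat 1" "matrix_inv A ** A = mat 1"
  using someI_ex[OF assms[unfolded invertible_def]] unfolding matrix_inv_def by blast+

text \<open>
  Lowering the free index turns the second derivative into the covector \<open>gram g p *v w\<close>, and this
  loses nothing because the Gram matrix is invertible.
\<close>

lemma geodesic_equation_lowered:
  assumes inv: "invertible (gram g p)"
  shows "(\<forall>k. w $ k + (\<Sum>i\<in>UNIV. \<Sum>j\<in>UNIV. christoffel g p k i j * v $ i * v $ j) = 0) \<longleftrightarrow>
     gram g p *v w + first_kind g p v = 0"
proof -
  let ?G = "gram g p"
  have l: "matrix_inv ?G *v (?G *v w + first_kind g p v) = w + matrix_inv ?G *v first_kind g p v"
    by (simp add: matrix_vector_right_distrib matrix_vector_mul_assoc matrix_inv_mult[OF inv])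
  have r: "?G *v (w + matrix_inv ?G *v first_kind g p v) = ?G *v w + first_kind g p v"
    by (simp add: matrix_vector_right_distrib matrix_vector_mul_assoc matrix_inv_mult[OF inv])
  have "(\<forall>k. w $ k + (\<Sum>i\<in>UNIV. \<Sum>j\<in>UNIV. christoffel g p k i j * v $ i * v $ j) = 0) \<longleftrightarrow>
      w + matrix_inv ?G *v first_kind g p v = 0"
    by (simp add: christoffel_quadratic vec_eq_iff)
  also have "\<dots> \<longleftrightarrow> ?G *v w + first_kind g p v = 0"
  proof
    assume "w + matrix_inv ?G *v first_kind g p v = 0"
    then show "?G *v w + first_kind g p v = 0" unfolding r[symmetric] by simp
  next
    assume "?G *v w + first_kind g p v = 0"
    then show "w + matrix_inv ?G *v first_kind g p v = 0" unfolding l[symmetric] by simp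
  qed
  finally show ?thesis .
qed

text \<open>
  The velocity and acceleration in the definition of a geodesic are determined by the curve, so
  the equation can be tested on any known derivatives.
\<close>

lemma geodesic_iff:
  assumes v: "\<And>t. (\<gamma> has_vector_derivative v t) (at t)"
    and w: "\<And>t. (v has_vector_derivative w t) (at t)"
    and inv: "\<And>p. invertible (gram g p)"
  shows "geodesic g \<gamma> \<longleftrightarrow> (\<forall>t. gram g (\<gamma> t) *v w t + first_kind g (\<gamma> t) (v t) = 0)"
proof
  assume "geodesic g \<gamma>"
  then obtain v' w' where v': "\<And>t. (\<gamma> has_vector_derivative v' t) (at t)"
    and w': "\<And>t. (v' has_vector_derivative w' t) (at t)"
    and eq: "\<And>t. \<forall>k. w' t $ k +
        (\<Sum>i\<in>UNIV. \<Sum>j\<in>UNIV. christoffel g (\<gamma> t) k i j * v' t $ i * v' t $ j) = 0"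
    unfolding geodesic_def by auto
  have "v' t = v t" for t by (rule vector_derivative_unique_at[OF v' v])
  then have v'_eq: "v' = v" ..
  have "w' t = w t" for t by (rule vector_derivative_unique_at[OF w'[unfolded v'_eq] w])
  then have w'_eq: "w' = w" ..
  show "\<forall>t. gram g (\<gamma> t) *v w t + first_kind g (\<gamma> t) (v t) = 0"
    using eq unfolding v'_eq w'_eq geodesic_equation_lowered[OF inv] by simp
next
  assume "\<forall>t. gram g (\<gamma> t) *v w t + first_kind g (\<gamma> t) (v t) = 0"
  then show "geodesic g \<gamma>"
    unfolding geodesic_def geodesic_equation_lowered[OF inv, symmetric]
    using v w by (intro exI[of _ v] exI[of _ w]) simp
qed

section \<open>The metric of the group\<close>

lemma sum_zc: "(\<Sum>i\<in>UNIV. zc p i) = 0"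
  by (simp add: UNIV_option_conv sum.reindex zc_def)

lemma linear_zc: "linear (\<lambda>p. zc p i)"
  by (rule linearI; cases i)
    (auto simp: zc_def sum.distrib sum_distrib_left sum_negf)

lemma zc_simps [simp]:
  "zc 0 i = 0" "zc (u + v) i = zc u i + zc v i" "zc (r *\<^sub>R v) i = r * zc v i"
  using linear_0[OF linear_zc] linear_add[OF linear_zc] linear_cmul[OF linear_zc] by auto

lemma zc_axis_Inl [simp]: "zc (axis (Inl i) 1) k = 0"
  by (cases k) (auto simp: zc_def axis_def)

lemma zc_axis_Inr:
  "zc (axis (Inr j) 1) None = - 1"
  "zc (axis (Inr j) 1) (Some k) = (if k = j then 1 else 0)"
  by (auto simp: zc_def axis_def)

lemma zc_eq_0_iff: "(\<forall>i. zc p i = 0) \<longleftrightarrow> (\<forall>j. p $ Inr j = 0)"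
  by (auto simp: zc_def split: option.splits)

text \<open>
  A symmetric function has the same sum below as above the diagonal, and the two triangles cover the
  square with the diagonal counted twice.
\<close>

lemma sum_triangle:
  fixes s :: "'a::{finite,linorder} \<Rightarrow> 'a \<Rightarrow> real"
  assumes sym: "\<And>k j. s k j = s j k"
  shows "2 * (\<Sum>j\<in>UNIV. \<Sum>k\<in>{..j}. s k j) = (\<Sum>j\<in>UNIV. \<Sum>k\<in>UNIV. s k j) + (\<Sum>j\<in>UNIV. s j j)"
proof -
  have tri: "(\<Sum>k\<in>{..j}. s k j) = (\<Sum>k\<in>UNIV. if k \<le> j then s k j else 0)" for j
    by (rule sum.mono_neutral_cong_left) auto
  have "(\<Sum>j\<in>UNIV. \<Sum>k\<in>{..j}. s k j) = (\<Sum>j\<in>UNIV. \<Sum>k\<in>UNIV. if k \<le> j then s k j else 0)"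
    by (simp add: tri)
  moreover have "(\<Sum>j\<in>UNIV. \<Sum>k\<in>UNIV. if k \<le> j then s k j else 0) =
      (\<Sum>j\<in>UNIV. \<Sum>k\<in>UNIV. if j \<le> k then s k j else 0)"
    by (subst sum.swap) (intro sum.cong refl, simp add: sym)
  ultimately have "2 * (\<Sum>j\<in>UNIV. \<Sum>k\<in>{..j}. s k j) =
      (\<Sum>j\<in>UNIV. \<Sum>k\<in>UNIV. (if k \<le> j then s k j else 0) + (if j \<le> k then s k j else 0))"
    by (simp add: sum.distrib)
  also have "\<dots> = (\<Sum>j\<in>UNIV. \<Sum>k\<in>UNIV. s k j + (if k = j then s k j else 0))"
    by (intro sum.cong refl) auto
  finally show ?thesis
    by (simp add: sum.distrib)
qed

text \<open>
  Over the full square, \<open>dz\<^sub>k dz\<^sub>j\<close> sums to \<open>(\<Sum> dz\<^sub>k)\<^sup>2 = 0\<close>, so by \<open>sum_triangle\<close> only half of the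
  diagonal remains.
\<close>

lemma group_metric_diag:
  "group_metric lam p u v =
     (\<Sum>i\<in>UNIV. exp (- 2 * zc p i) * u $ Inl i * v $ Inl i) +
     lam\<^sup>2 / 2 * (\<Sum>i\<in>UNIV. zc u i * zc v i)"
proof -
  let ?s = "\<lambda>k j. (zc u k * zc v j + zc u j * zc v k) / 2"
  have "(\<Sum>j\<in>UNIV. \<Sum>k\<in>UNIV. ?s k j) = 0"
    by (simp add: sum.distrib sum_divide_distrib[symmetric] sum_distrib_left[symmetric]
        sum_distrib_right[symmetric] sum_zc)
  then have "2 * (\<Sum>j\<in>UNIV. \<Sum>k\<in>{..j}. ?s k j) = (\<Sum>j\<in>UNIV. zc u j * zc v j)"
    by (subst sum_triangle) auto
  then show ?thesis
    by (simp add: group_metric_def)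
qed

lemma linear_group_metric: "linear (\<lambda>u. group_metric lam p u v)"
  by (rule linearI)
    (auto simp: group_metric_diag sum.distrib algebra_simps sum_distrib_left)

lemma linear_sum_axis:
  fixes f :: "real^'m \<Rightarrow> real"
  assumes "linear f"
  shows "(\<Sum>i\<in>UNIV. f (axis i 1) * v $ i) = f v"
proof -
  have "f v = f (\<Sum>i\<in>UNIV. v $ i *\<^sub>R axis i 1)"
    by (simp add: basis_expansion[of v, unfolded scalar_mult_eq_scaleR])
  also have "\<dots> = (\<Sum>i\<in>UNIV. v $ i * f (axis i 1))"
    by (simp add: linear_sum[OF assms] linear_cmul[OF assms])
  finally show ?thesis by (simp add: mult.commute)
qed

lemma group_metric_commute: "group_metric lam p u v = group_metric lam p v u"
  by (simp add: group_metric_diag mult_ac)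

lemma gram_mult: "(gram (group_metric lam) p *v w) $ m = group_metric lam p w (axis m 1)"
  using linear_sum_axis[OF linear_group_metric[of lam p "axis m 1"], of w]
  by (simp add: gram_def matrix_vector_mult_def group_metric_commute)

lemma group_metric_self_eq_0:
  assumes "lam \<noteq> 0" "group_metric lam p u u = 0"
  shows "u = 0"
proof -
  have nn: "0 \<le> (\<Sum>i\<in>UNIV. exp (- 2 * zc p i) * u $ Inl i * u $ Inl i)"
      "0 \<le> lam\<^sup>2 / 2 * (\<Sum>i\<in>UNIV. zc u i * zc u i)"
    by (auto intro!: sum_nonneg mult_nonneg_nonneg[of "lam\<^sup>2"] simp: mult.assoc)
  then have x: "(\<Sum>i\<in>UNIV. exp (- 2 * zc p i) * u $ Inl i * u $ Inl i) = 0"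
    and z: "(\<Sum>i\<in>UNIV. zc u i * zc u i) = 0"
    using assms unfolding group_metric_diag add_nonneg_eq_0_iff[OF nn] by auto
  have "u $ Inl i = 0" for i
    using x by (subst (asm) sum_nonneg_eq_0_iff) (auto simp: mult.assoc)
  moreover have "\<forall>i. zc u i = 0"
    using z by (subst (asm) sum_nonneg_eq_0_iff) auto
  ultimately show "u = 0"
    unfolding zc_eq_0_iff by (simp add: vec_eq_iff split_sum_all)
qed

lemma invertible_gram:
  assumes "lam \<noteq> 0"
  shows "invertible (gram (group_metric lam) p)"
proof -
  have "u = 0" if "gram (group_metric lam) p *v u = 0" for u
  proof (rule group_metric_self_eq_0[OF assms])
    have "group_metric lam p u (axis m 1) = 0" for m
      using gram_mult[of lam p u m] that by simp
    then show "group_metric lam p u u = 0"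
      using linear_sum_axis[OF linear_group_metric[of lam p u], of u]
      by (simp add: group_metric_commute)
  qed
  then show ?thesis
    unfolding invertible_left_inverse matrix_left_invertible_ker by blast
qed

text \<open>
  The derivative of the metric at \<open>p\<close> in the direction \<open>w\<close>: only the coefficients \<open>e\<^sup>-\<^sup>2\<^sup>z\<close> of the
  \<open>dx\<^sub>i\<^sup>2\<close> vary.
\<close>

definition metric_deriv :: "'n::finite coords \<Rightarrow> 'n coords \<Rightarrow> 'n coords \<Rightarrow> 'n coords \<Rightarrow> real" where
  "metric_deriv p w u v = (\<Sum>k\<in>UNIV. - 2 * zc w k * exp (- 2 * zc p k) * u $ Inl k * v $ Inl k)"

lemma dgram_group_metric:
  "dgram (group_metric lam) p l i j = metric_deriv p (axis l 1) (axis i 1) (axis j 1)"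
  unfolding dgram_def gram_def group_metric_diag metric_deriv_def
  by (rule DERIV_imp_deriv)
    (auto intro!: derivative_eq_intros sum.cong)

lemma linear_metric_deriv:
  "linear (\<lambda>w. metric_deriv p w u v)"
  "linear (\<lambda>u. metric_deriv p w u v)"
  "linear (\<lambda>v. metric_deriv p w u v)"
  by (rule linearI; simp add: metric_deriv_def algebra_simps sum_distrib_left flip: sum.distrib)+

lemma bilinear_sum_axis:
  assumes "\<And>b. linear (\<lambda>a. f a b)" "\<And>a. linear (f a)"
  shows "(\<Sum>i\<in>UNIV. \<Sum>j\<in>UNIV. f (axis i 1) (axis j 1) * v $ i * v $ j) = (f v v :: real)"
proof -
  have "(\<Sum>i\<in>UNIV. \<Sum>j\<in>UNIV. f (axis i 1) (axis j 1) * v $ i * v $ j) =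
      (\<Sum>i\<in>UNIV. (\<Sum>j\<in>UNIV. f (axis i 1) (axis j 1) * v $ j) * v $ i)"
    by (simp add: sum_distrib_left mult_ac)
  then show ?thesis
    by (simp add: linear_sum_axis[OF assms(2)] linear_sum_axis[OF assms(1)])
qed

lemma first_kind_group_metric:
  "first_kind (group_metric lam) p v $ m =
     metric_deriv p v v (axis m 1) - metric_deriv p (axis m 1) v v / 2"
proof -
  let ?D = "metric_deriv p" and ?e = "\<lambda>i. axis i 1"
  have sym: "?D w a b = ?D w b a" for w a b
    by (simp add: metric_deriv_def mult_ac)
  have 1: "(\<Sum>i\<in>UNIV. \<Sum>j\<in>UNIV. ?D (?e i) (?e j) (?e m) * v $ i * v $ j) = ?D v v (?e m)"
    by (rule bilinear_sum_axis) (rule linear_metric_deriv)+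
  have 2: "(\<Sum>i\<in>UNIV. \<Sum>j\<in>UNIV. ?D (?e j) (?e i) (?e m) * v $ i * v $ j) = ?D v v (?e m)"
    by (rule bilinear_sum_axis[of "\<lambda>a b. ?D b a (?e m)"]) (rule linear_metric_deriv)+
  have 3: "(\<Sum>i\<in>UNIV. \<Sum>j\<in>UNIV. ?D (?e m) (?e i) (?e j) * v $ i * v $ j) = ?D (?e m) v v"
    by (rule bilinear_sum_axis) (rule linear_metric_deriv)+
  have "2 * first_kind (group_metric lam) p v $ m =
      (\<Sum>i\<in>UNIV. \<Sum>j\<in>UNIV. ?D (?e i) (?e j) (?e m) * v $ i * v $ j
        + ?D (?e j) (?e i) (?e m) * v $ i * v $ j - ?D (?e m) (?e i) (?e j) * v $ i * v $ j)"
    unfolding first_kind_def dgram_group_metric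
    by (auto simp: sum_distrib_left field_simps intro!: sum.cong)
  also have "\<dots> = 2 * ?D v v (?e m) - ?D (?e m) v v"
    by (simp add: sum.distrib sum_subtractf 1 2 3)
  finally show ?thesis by simp
qed

section \<open>One-parameter subgroups\<close>

lemma sum_UNIV_sum:
  "(\<Sum>k\<in>UNIV. f k) = (\<Sum>i\<in>UNIV. f (Inl i)) + (\<Sum>j\<in>UNIV. f (Inr j))"
  for f :: "'a::finite + 'b::finite \<Rightarrow> 'c::comm_monoid_add"
  using sum.Plus[of "UNIV :: 'a set" "UNIV :: 'b set" f] by (simp add: comp_def)

text \<open>
  Every power from the first on has zero last row, so each further multiplication from the left only
  scales row \<open>i\<close> by \<open>z\<^sub>i\<close>. The last column is one power behind the diagonal because it starts with
  the entries \<open>x\<^sub>i\<close> of the first power.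
\<close>

lemma mat_power_algebra_elem:
  fixes X :: "'n::finite coords"
  shows "(((**) (algebra_elem X)) ^^ k) (mat 1) = (\<chi> r c. case r of
       Inl i \<Rightarrow> (case c of Inl j \<Rightarrow> (if i = j then zc X i ^ k else 0)
                       | Inr _ \<Rightarrow> (if k = 0 then 0 else X $ Inl i * zc X i ^ (k - 1)))
     | Inr _ \<Rightarrow> (case c of Inl _ \<Rightarrow> 0 | Inr _ \<Rightarrow> (if k = 0 then 1 else 0)))"
proof (induction k)
  case 0
  then show ?case
    by (auto simp: vec_eq_iff mat_def split: sum.split)
next
  case (Suc k)
  show ?case
    unfolding funpow.simps comp_def Suc
    by (cases k; simp add: vec_eq_iff matrix_matrix_mult_def algebra_elem_def sum_UNIV_sum split_sum_all;
        simp add: if_distrib if_distribR cong: if_cong)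
qed

text \<open>
  The one-parameter subgroup in coordinates. The value for \<open>zc X i = 0\<close> is the limit of
  \<open>(e\<^sup>t\<^sup>z - 1) / z\<close> as \<open>z\<close> tends to \<open>0\<close>, so that the velocity of \<open>x\<^sub>i\<close> is \<open>X\<^sub>i e\<^sup>t\<^sup>z\<close> in both cases.
\<close>

definition one_param :: "'n::finite coords \<Rightarrow> real \<Rightarrow> 'n coords" where
  "one_param X t = (\<chi> m. case m of
       Inl i \<Rightarrow> (if zc X i = 0 then t * X $ Inl i
                else X $ Inl i * (exp (t * zc X i) - 1) / zc X i)
     | Inr j \<Rightarrow> t * X $ Inr j)"

lemma zc_one_param: "zc (one_param X t) i = t * zc X i"
  by (cases i) (simp_all add: zc_def one_param_def sum_distrib_left)

lemma vec_sums:
  fixes f :: "nat \<Rightarrow> 'a::real_normed_vector^'m"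
  assumes "\<And>i. (\<lambda>k. f k $ i) sums (s $ i)"
  shows "f sums s"
  using assms unfolding sums_def by (intro vec_tendstoI) simp

lemma exp_minus_1_sums:
  fixes b :: real
  assumes "b \<noteq> 0"
  shows "(\<lambda>k. if k = 0 then 0 else b ^ (k - 1) / fact k) sums ((exp b - 1) / b)"
proof -
  define f where "f k = (if k = 0 then 0 else b ^ (k - 1) / fact k)" for k :: nat
  have "(\<lambda>k. b ^ Suc k /\<^sub>R fact (Suc k)) sums (exp b - 1)"
    using exp_converges[of b] by (subst sums_Suc_iff) simp
  then have "(\<lambda>k. b ^ Suc k /\<^sub>R fact (Suc k) / b) sums ((exp b - 1) / b)"
    by (rule sums_divide)
  moreover have "(\<lambda>k. b ^ Suc k /\<^sub>R fact (Suc k) / b) = (\<lambda>k. f (Suc k))"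
    using assms by (auto simp: f_def fun_eq_iff divide_simps)
  ultimately have "f sums ((exp b - 1) / b + f 0)"
    by (simp add: sums_Suc_iff)
  then show ?thesis
    by (simp add: f_def[abs_def] cong: if_cong)
qed

lemma mexp_algebra_elem: "mexp (t *\<^sub>R algebra_elem X) = group_elem (one_param X t)"
proof -
  let ?Y = "t *\<^sub>R X"
  have scale: "t *\<^sub>R algebra_elem X = algebra_elem ?Y"
    by (auto simp: vec_eq_iff algebra_elem_def split: sum.split)
  have "(\<lambda>k. (1 / fact k) *\<^sub>R (((**) (algebra_elem ?Y)) ^^ k) (mat 1)) sums group_elem (one_param X t)"
  proof (intro vec_sums)
    fix r c
    show "(\<lambda>k. ((1 / fact k) *\<^sub>R (((**) (algebra_elem ?Y)) ^^ k) (mat 1)) $ r $ c) sums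
        (group_elem (one_param X t) $ r $ c)"
    proof (cases r)
      case r: (Inl i)
      show ?thesis
      proof (cases c)
        case (Inl j)
        have "(\<lambda>k. (t * zc X i) ^ k /\<^sub>R fact k) sums exp (t * zc X i)"
          by (rule exp_converges)
        then show ?thesis
          unfolding mat_power_algebra_elem group_elem_def
          by (auto simp: r Inl zc_one_param divide_inverse mult_ac)
      next
        case (Inr u)
        have "(\<lambda>k. (1 / fact k) * (if k = 0 then 0 else t * X $ Inl i * (t * zc X i) ^ (k - 1)))
            sums (one_param X t $ Inl i)"
        proof (cases "t * zc X i = 0")
          case True
          have "(\<lambda>k. (1 / fact k) * (if k = 0 then 0 else t * X $ Inl i * (t * zc X i) ^ (k - 1))) =
              (\<lambda>k. if k = 1 then t * X $ Inl i else 0)"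
            using True by (auto simp: fun_eq_iff power_0_left)
          moreover have "one_param X t $ Inl i = t * X $ Inl i"
            using True by (auto simp: one_param_def)
          ultimately show ?thesis
            using sums_single[of 1 "\<lambda>_. t * X $ Inl i"] by simp
        next
          case False
          have "(\<lambda>k. t * X $ Inl i * (if k = 0 then 0 else (t * zc X i) ^ (k - 1) / fact k))
              sums (t * X $ Inl i * ((exp (t * zc X i) - 1) / (t * zc X i)))"
            by (rule sums_mult[OF exp_minus_1_sums[OF False]])
          moreover have "t * X $ Inl i * ((exp (t * zc X i) - 1) / (t * zc X i)) = one_param X t $ Inl i"
            using False by (simp add: one_param_def)
          moreover have "(\<lambda>k. t * X $ Inl i * (if k = 0 then 0 else (t * zc X i) ^ (k - 1) / fact k)) =
            (\<lambda>k. (1 / fact k) * (if k = 0 then 0 else t * X $ Inl i * (t * zc X i) ^ (k - 1)))"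
            by auto
          ultimately show ?thesis by simp
        qed
        then show ?thesis
          unfolding mat_power_algebra_elem group_elem_def
          by (simp add: r Inr cong: if_cong)
      qed
    next
      case r: (Inr u)
      show ?thesis
      proof (cases c)
        case (Inl j)
        then show ?thesis
          unfolding mat_power_algebra_elem group_elem_def by (simp add: r)
      next
        case (Inr u')
        have "(\<lambda>k::nat. 1 / fact k * (if k = 0 then 1 else 0 :: real)) = (\<lambda>k. if k = 0 then 1 else 0)"
          by auto
        then show ?thesis
          unfolding mat_power_algebra_elem group_elem_def 
          using sums_single[of 0 "\<lambda>_. 1::real"] by (simp add: r Inr)
      qed
    qed
  qed
  then show ?thesis
    unfolding mexp_def scale by (simp add: sums_iff)
qed

lemma inj_group_elem: "inj group_elem"
proof (rule injI)
  fix p q :: "'n::finite coords"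
  assume "group_elem p = group_elem q"
  then have eq: "group_elem p $ r $ c = group_elem q $ r $ c" for r c by simp
  have "p $ Inl i = q $ Inl i" for i
    using eq[of "Inl i" "Inr ()"] by (simp add: group_elem_def)
  moreover have "p $ Inr j = q $ Inr j" for j
    using eq[of "Inl (Some j)" "Inl (Some j)"] by (simp add: group_elem_def zc_def)
  ultimately show "p = q"
    by (simp add: vec_eq_iff split_sum_all)
qed

text \<open>
  The parameters are global coordinates (\<open>inj_group_elem\<close>), so \<open>one_param X\<close> is the only curve that
  can witness homogeneity.
\<close>

lemma homogeneous_vector_one_param:
  "homogeneous_vector lam X \<longleftrightarrow> X \<noteq> 0 \<and> geodesic (group_metric lam) (one_param X)"
proof -
  have "(\<forall>t. group_elem (\<gamma> t) = mexp (t *\<^sub>R algebra_elem X)) \<longleftrightarrow> \<gamma> = one_param X" for \<gamma>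
    unfolding mexp_algebra_elem by (auto simp: fun_eq_iff inj_eq[OF inj_group_elem])
  then show ?thesis
    by (simp add: homogeneous_vector_def)
qed

lemma has_vector_derivative_vec:
  fixes f :: "real \<Rightarrow> real^'m"
  assumes "\<And>i. ((\<lambda>t. f t $ i) has_real_derivative d $ i) (at t)"
  shows "(f has_vector_derivative d) (at t)"
  using assms unfolding has_vector_derivative_def has_field_derivative_def
  by (subst has_derivative_componentwise_within[of f]) 
     (auto simp: Basis_vec_def inner_axis mult.commute[of _ "d $ _"])

text \<open>
  Along \<open>one_param X\<close> the exponential factors of the metric and of the velocity combine: the
  \<open>x\<^sub>i\<close>-component of the lowered geodesic equation is \<open>- a\<^sub>i b\<^sub>i\<close> times an exponential, and the
  \<open>z\<^sub>j\<close>-component is \<open>a\<^sub>j\<^sup>2 - a\<^sub>0\<^sup>2\<close>, where the index \<open>0\<close> enters because \<open>z\<^sub>0\<close> decreases with each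
  \<open>z\<^sub>j\<close>. The term with \<open>lam\<close> drops out because the \<open>z\<^sub>j\<close> are linear in time.
\<close>

lemma homogeneous_vector_iff:
  fixes X :: "'n::{finite,linorder} coords"
  assumes lam: "lam \<noteq> 0"
  shows "homogeneous_vector lam X \<longleftrightarrow>
    X \<noteq> 0 \<and> (\<forall>i. X $ Inl i * zc X i = 0) \<and> (\<forall>j. (X $ Inl (Some j))\<^sup>2 = (X $ Inl None)\<^sup>2)"
proof -
  define v :: "real \<Rightarrow> 'n coords" where "v t = (\<chi> m. case m of
      Inl i \<Rightarrow> X $ Inl i * exp (t * zc X i) | Inr j \<Rightarrow> X $ Inr j)" for t
  define w :: "real \<Rightarrow> 'n coords" where "w t = (\<chi> m. case m of
      Inl i \<Rightarrow> X $ Inl i * zc X i * exp (t * zc X i) | Inr j \<Rightarrow> 0)" for t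
  have v: "(one_param X has_vector_derivative v t) (at t)" for t
  proof (rule has_vector_derivative_vec)
    fix m show "((\<lambda>t. one_param X t $ m) has_real_derivative v t $ m) (at t)"
      proof (cases m)
      case (Inl i)
      then show ?thesis
        by (cases "zc X i = 0") (auto simp: one_param_def v_def intro!: derivative_eq_intros)
    qed (auto simp: one_param_def v_def intro!: derivative_eq_intros)
  qed
  have w: "(v has_vector_derivative w t) (at t)" for t
  proof (rule has_vector_derivative_vec)
    fix m show "((\<lambda>t. v t $ m) has_real_derivative w t $ m) (at t)"
      by (cases m) (auto simp: w_def v_def intro!: derivative_eq_intros)
  qed
  have zv: "zc (v t) i = zc X i" and zw: "zc (w t) i = 0" for t i
    by (cases i; simp add: v_def w_def zc_def)+
  have vx: "v t $ Inl i = X $ Inl i * exp (t * zc X i)"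
    and wx: "w t $ Inl i = X $ Inl i * zc X i * exp (t * zc X i)" for t i
    by (simp_all add: v_def w_def)
  have axis_Inl: "axis (Inl i) 1 $ Inl k = (if k = i then 1 else 0 :: real)" for i k
    by (simp add: axis_def)
  have x: "(gram (group_metric lam) (one_param X t) *v w t
        + first_kind (group_metric lam) (one_param X t) (v t)) $ Inl i =
      - (X $ Inl i * zc X i * exp (- t * zc X i))" for t i
  proof -
    have "exp (t * zc X i) * exp (- 2 * (t * zc X i)) = exp (- t * zc X i)"
      by (simp add: exp_add[symmetric])
    then show ?thesis
      by (simp add: gram_mult first_kind_group_metric group_metric_diag metric_deriv_def zv zw
          zc_one_param vx wx axis_Inl if_distrib cong: if_cong)
  qed
  have z: "(gram (group_metric lam) (one_param X t) *v w t
        + first_kind (group_metric lam) (one_param X t) (v t)) $ Inr j =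
      (X $ Inl (Some j))\<^sup>2 - (X $ Inl None)\<^sup>2" for t j
  proof -
    have e: "exp (- 2 * (t * a)) * (y * exp (t * a)) * (y * exp (t * a)) = y\<^sup>2" for a y :: real
    proof -
      have "exp (- 2 * (t * a)) * (exp (t * a) * exp (t * a)) = 1"
        by (simp flip: exp_add)
      moreover have "exp (- 2 * (t * a)) * (y * exp (t * a)) * (y * exp (t * a)) =
          exp (- 2 * (t * a)) * (exp (t * a) * exp (t * a)) * y\<^sup>2"
        by (simp only: power2_eq_square mult_ac)
      ultimately show ?thesis by simp
    qed
    have "metric_deriv (one_param X t) (axis (Inr j) 1) (v t) (v t) =
        (\<Sum>k\<in>UNIV. - 2 * zc (axis (Inr j) 1) k * (exp (- 2 * (t * zc X k)) *
          (X $ Inl k * exp (t * zc X k)) * (X $ Inl k * exp (t * zc X k))))"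
      unfolding metric_deriv_def zc_one_param vx by (simp only: mult.assoc)
    also have "\<dots> = (\<Sum>k\<in>UNIV. - 2 * zc (axis (Inr j) 1) k * (X $ Inl k)\<^sup>2)"
      unfolding e ..
    also have "\<dots> = 2 * (X $ Inl None)\<^sup>2 +
        (\<Sum>k\<in>UNIV. - 2 * (if k = j then 1 else 0) * (X $ Inl (Some k))\<^sup>2)"
      by (simp add: UNIV_option_conv sum.reindex zc_axis_Inr)
    also have "(\<Sum>k\<in>UNIV. - 2 * (if k = j then 1 else 0) * (X $ Inl (Some k))\<^sup>2) =
        (\<Sum>k\<in>UNIV. if k = j then - 2 * (X $ Inl (Some k))\<^sup>2 else 0)"
      by (intro sum.cong refl) simp
    finally have d: "metric_deriv (one_param X t) (axis (Inr j) 1) (v t) (v t) =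
        2 * (X $ Inl None)\<^sup>2 - 2 * (X $ Inl (Some j))\<^sup>2"
      by simp
    have "(axis (Inr j) 1 :: 'n coords) $ Inl k = 0" for k
      by (simp add: axis_def)
    then have "metric_deriv (one_param X t) (v t) (v t) (axis (Inr j) 1) = 0"
      and "group_metric lam (one_param X t) (w t) (axis (Inr j) 1) = 0"
      by (simp_all add: metric_deriv_def group_metric_diag zw)
    then show ?thesis
      by (simp add: gram_mult first_kind_group_metric d field_simps)
  qed
  have "geodesic (group_metric lam) (one_param X) \<longleftrightarrow>
     (\<forall>t. (\<forall>i. X $ Inl i * zc X i = 0) \<and> (\<forall>j. (X $ Inl (Some j))\<^sup>2 = (X $ Inl None)\<^sup>2))"
    unfolding geodesic_iff[OF v w invertible_gram[OF lam]] vec_eq_iff[of _ 0] split_sum_all x z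
    by auto
  then show ?thesis
    by (auto simp: homogeneous_vector_one_param)
qed

section \<open>Orthogonal sets of sign vectors\<close>

definition sign_vector :: "real^'a \<Rightarrow> bool" where
  "sign_vector s \<longleftrightarrow> (\<forall>i. s $ i = 1 \<or> s $ i = - 1)"

definition orthogonal_sign_sets :: "(real^'a) set set" where
  "orthogonal_sign_sets = {A. (\<forall>s\<in>A. sign_vector s) \<and> pairwise orthogonal A}"

lemma sum_if_count: "(\<Sum>i\<in>UNIV. if P i then c else 0 :: real) = c * card {i::'a::finite. P i}"
  by (simp add: sum.If_cases)

text \<open>
  The products \<open>s\<^sub>i t\<^sub>i\<close> are signs that sum to zero, so adding \<open>1\<close> to each shows that the dimension
  is twice the number of places where \<open>s\<close> and \<open>t\<close> agree.
\<close>

lemma orthogonal_signs_even: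
  fixes s t :: "real^'a"
  assumes "sign_vector s" "sign_vector t" "orthogonal s t"
  shows "even CARD('a)"
proof -
  have "real CARD('a) = (\<Sum>i\<in>UNIV. 1 + s $ i * t $ i)"
    using assms(3) by (simp add: sum.distrib orthogonal_def inner_vec_def)
  also have "\<dots> = (\<Sum>i\<in>UNIV. if s $ i = t $ i then 2 else 0)"
  proof (intro sum.cong refl)
    fix i
    have "s $ i \<in> {1, -1}" "t $ i \<in> {1, -1}"
      using assms(1,2) by (auto simp: sign_vector_def)
    then show "1 + s $ i * t $ i = (if s $ i = t $ i then 2 else 0)"
      by (elim insertE emptyE) simp_all
  qed
  also have "\<dots> = real (2 * card {i. s $ i = t $ i})"
    by (simp add: sum_if_count)
  finally show ?thesis
    unfolding of_nat_eq_iff by simp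
qed

text \<open>
  Expanding \<open>\<Sum>\<^sub>i (s\<^sub>i + t\<^sub>i) (s\<^sub>i + u\<^sub>i)\<close>, orthogonality leaves only \<open>\<Sum>\<^sub>i s\<^sub>i\<^sup>2\<close>, which is the
  dimension; but each term is \<open>4\<close> where the three signs agree and \<open>0\<close> elsewhere.
\<close>

lemma three_orthogonal_signs_dvd:
  fixes s t u :: "real^'a"
  assumes signs: "sign_vector s" "sign_vector t" "sign_vector u"
    and orth: "orthogonal s t" "orthogonal s u" "orthogonal t u"
  shows "4 dvd CARD('a)"
proof -
  have "s $ i * s $ i = 1" for i
    using signs(1)[unfolded sign_vector_def, rule_format, of i] by auto
  then have "real CARD('a) = (\<Sum>i\<in>UNIV. (s $ i + t $ i) * (s $ i + u $ i))"
    using orth by (simp add: sum.distrib orthogonal_def inner_vec_def algebra_simps)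
  also have "\<dots> = (\<Sum>i\<in>UNIV. if s $ i = t $ i \<and> s $ i = u $ i then 4 else 0)"
  proof (intro sum.cong refl)
    fix i
    have "s $ i \<in> {1, -1}" "t $ i \<in> {1, -1}" "u $ i \<in> {1, -1}"
      using signs by (auto simp: sign_vector_def)
    then show "(s $ i + t $ i) * (s $ i + u $ i) = (if s $ i = t $ i \<and> s $ i = u $ i then 4 else 0)"
      by (elim insertE emptyE) simp_all
  qed
  also have "\<dots> = real (4 * card {i. s $ i = t $ i \<and> s $ i = u $ i})"
    by (simp add: sum_if_count)
  finally show ?thesis
    unfolding of_nat_eq_iff by simp
qed

lemma sign_vector_nonzero: "sign_vector s \<Longrightarrow> s \<noteq> 0"
  by (auto simp: sign_vector_def)

lemma orthogonal_sign_set_bound: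
  fixes A :: "(real^'a) set"
  assumes "A \<in> orthogonal_sign_sets"
  shows "finite A" "card A \<le> CARD('a)"
proof -
  have "independent A"
    using assms sign_vector_nonzero
    by (intro pairwise_orthogonal_independent) (auto simp: orthogonal_sign_sets_def)
  then show "finite A" "card A \<le> CARD('a)"
    using independent_bound[of A] by auto
qed

lemma sign_vector_1: "sign_vector 1"
  by (simp add: sign_vector_def)

lemma max_card_signs_odd:
  assumes "odd CARD('a)"
  shows "max_card_in (orthogonal_sign_sets :: (real^'a) set set) 1"
  unfolding max_card_in_def
proof (intro conjI ballI)
  show "\<exists>S\<in>orthogonal_sign_sets. finite S \<and> card (S :: (real^'a) set) = 1"
    by (rule bexI[of _ "{1}"]) (auto simp: orthogonal_sign_sets_def sign_vector_1)
next
  fix A :: "(real^'a) set"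
  assume A: "A \<in> orthogonal_sign_sets"
  then show fin: "finite A" by (rule orthogonal_sign_set_bound)
  have "s = t" if "s \<in> A" "t \<in> A" for s t
    using A that orthogonal_signs_even[of s t] assms
    unfolding orthogonal_sign_sets_def pairwise_def by blast
  then show "card A \<le> 1"
    using card_le_Suc0_iff_eq[OF fin] by simp
qed

lemma max_card_signs_even:
  assumes "even CARD('a)" "\<not> 4 dvd CARD('a)"
  shows "max_card_in (orthogonal_sign_sets :: (real^'a) set set) 2"
  unfolding max_card_in_def
proof (intro conjI ballI)
  obtain H :: "'a set" where H: "card H = CARD('a) div 2"
    using obtain_subset_with_card_n[of "CARD('a) div 2" "UNIV :: 'a set"] by auto
  define s :: "real^'a" where "s = (\<chi> i. if i \<in> H then 1 else - 1)"
  have "card (- H) = CARD('a) div 2"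
    using assms(1) H by (auto simp: Compl_eq_Diff_UNIV card_Diff_subset elim!: evenE)
  then have orth: "orthogonal 1 s"
    using H by (simp add: s_def orthogonal_def inner_vec_def sum.If_cases Compl_eq[symmetric])
  moreover have "\<not> orthogonal 1 (1 :: real^'a)"
    by (simp add: orthogonal_def inner_vec_def)
  ultimately have "1 \<noteq> s" by metis
  moreover have "sign_vector s"
    by (simp add: s_def sign_vector_def)
  ultimately show "\<exists>S\<in>orthogonal_sign_sets. finite S \<and> card (S :: (real^'a) set) = 2"
    using orth
    by (intro bexI[of _ "{1, s}"])
      (auto simp: orthogonal_sign_sets_def sign_vector_1 pairwise_insert orthogonal_commute)
next
  fix A :: "(real^'a) set"
  assume A: "A \<in> orthogonal_sign_sets"
  then show "finite A" by (rule orthogonal_sign_set_bound)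
  show "card A \<le> 2"
  proof (rule ccontr)
    assume "\<not> card A \<le> 2"
    then obtain B where "B \<subseteq> A" "card B = 3"
      using obtain_subset_with_card_n[of 3 A] by auto
    then obtain s t u where "s \<in> A" "t \<in> A" "u \<in> A" "s \<noteq> t" "s \<noteq> u" "t \<noteq> u"
      unfolding card_3_iff by auto
    then have "4 dvd CARD('a)"
      using A by (intro three_orthogonal_signs_dvd[of s t u])
        (auto simp: orthogonal_sign_sets_def pairwise_def)
    with assms(2) show False ..
  qed
qed

lemma max_card_signs_hadamard:
  fixes H :: "real^'a^'a"
  assumes "hadamard_matrix H"
  shows "max_card_in (orthogonal_sign_sets :: (real^'a) set set) CARD('a)"
  unfolding max_card_in_def
proof (intro conjI ballI)
  have inner: "H $ i \<bullet> H $ j = (if i = j then real CARD('a) else 0)" for i j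
  proof -
    have "(H ** transpose H) $ i $ j = (of_nat CARD('a) *\<^sub>R (mat 1 :: real^'a^'a)) $ i $ j"
      using assms by (simp add: hadamard_matrix_def)
    then show ?thesis
      by (simp add: matrix_matrix_mult_def transpose_def mat_def inner_vec_def)
  qed
  have "inj (($) H)"
    by (rule injI, rule ccontr) (metis inner of_nat_0_eq_iff zero_less_card_finite less_irrefl)
  then have "card (range (($) H)) = CARD('a)"
    by (rule card_image)
  then show "\<exists>S\<in>orthogonal_sign_sets. finite S \<and> card (S :: (real^'a) set) = CARD('a)"
    using assms
    by (intro bexI[of _ "range (($) H)"])
      (auto simp: orthogonal_sign_sets_def sign_vector_def hadamard_matrix_def pairwise_def
        orthogonal_def inner)
qed (use orthogonal_sign_set_bound in auto)

section \<open>Orthogonal sets of homogeneous vectors\<close>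

text \<open>
  The embeddings of \<open>\<real>\<^sup>n\<^sup>+\<^sup>1\<close> as the \<open>x\<close>-directions and of its zero-sum hyperplane as the
  \<open>z\<close>-directions. The component \<open>b $ None\<close> is not stored by \<open>zvec\<close>: on the hyperplane it is
  recovered by \<open>zc\<close>.
\<close>

definition xvec :: "real^('n option) \<Rightarrow> 'n::finite coords" where
  "xvec a = (\<chi> m. case m of Inl i \<Rightarrow> a $ i | Inr j \<Rightarrow> 0)"

definition zvec :: "real^('n option) \<Rightarrow> 'n::finite coords" where
  "zvec b = (\<chi> m. case m of Inl i \<Rightarrow> 0 | Inr j \<Rightarrow> b $ Some j)"

lemma xvec_simps [simp]: "xvec a $ Inl i = a $ i" "xvec a $ Inr j = 0" "zc (xvec a) k = 0"
  by (simp_all add: xvec_def zc_def split: option.split)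

lemma zvec_simps [simp]: "zvec b $ Inl i = 0" "zvec b $ Inr j = b $ Some j"
  by (simp_all add: zvec_def)

lemma zc_zvec: "(\<Sum>i\<in>UNIV. b $ i) = 0 \<Longrightarrow> zc (zvec b) k = b $ k"
  by (cases k) (simp_all add: zc_def zvec_def UNIV_option_conv sum.reindex)

lemma homogeneous_zvec:
  fixes b :: "real^('n::{finite,linorder} option)"
  assumes "lam \<noteq> 0" "(\<Sum>i\<in>UNIV. b $ i) = 0" "b \<noteq> 0"
  shows "homogeneous_vector lam (zvec b)"
proof -
  have "zvec b \<noteq> 0"
    using assms(3) zc_zvec[OF assms(2)] by (auto simp: vec_eq_iff[of b])
  then show ?thesis
    by (simp add: homogeneous_vector_iff[OF assms(1)])
qed

lemma homogeneous_xvec: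
  fixes s :: "real^('n::{finite,linorder} option)"
  assumes "lam \<noteq> 0" "sign_vector s"
  shows "homogeneous_vector lam (xvec s)"
proof -
  have "(s $ i)\<^sup>2 = 1" for i
    using assms(2) by (auto simp: sign_vector_def power2_eq_1_iff)
  moreover have "xvec s \<noteq> 0"
    using sign_vector_nonzero[OF assms(2)] by (auto simp: vec_eq_iff split_sum_all)
  ultimately show ?thesis
    by (simp add: homogeneous_vector_iff[OF assms(1)])
qed

lemma homogeneous_vector_cases:
  assumes "lam \<noteq> 0" "homogeneous_vector lam X"
  obtains (z) "\<And>i. X $ Inl i = 0" "\<exists>i. zc X i \<noteq> 0"
    | (x) c s where "\<And>i. zc X i = 0" "c \<noteq> 0" "sign_vector s" "\<And>i. X $ Inl i = c * s $ i"
proof -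
  have X: "X \<noteq> 0" "\<And>i. X $ Inl i * zc X i = 0" "\<And>j. (X $ Inl (Some j))\<^sup>2 = (X $ Inl None)\<^sup>2"
    using assms(2) by (auto simp: homogeneous_vector_iff[OF assms(1)])
  define c where "c = \<bar>X $ Inl None\<bar>"
  have c: "\<bar>X $ Inl i\<bar> = c" for i
    using X(3)[of "the i"] by (cases i) (simp_all add: c_def power2_eq_iff abs_eq_iff)
  show ?thesis
  proof (cases "c = 0")
    case True
    then have "X $ Inl i = 0" for i
      using c[of i] by simp
    moreover from this have "\<exists>i. zc X i \<noteq> 0"
      using X(1) zc_eq_0_iff[of X] by (auto simp: vec_eq_iff split_sum_all)
    ultimately show ?thesis by (rule z)
  next
    case False
    then have "X $ Inl i \<noteq> 0" for i
      using c[of i] by auto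
    then have "zc X i = 0" "sign_vector (\<chi> i. sgn (X $ Inl i))" for i
      using X(2)[of i] by (auto simp: sign_vector_def sgn_if)
    moreover have "X $ Inl i = c * (\<chi> i. sgn (X $ Inl i)) $ i" for i
      unfolding c[of i, symmetric] by (simp add: abs_mult_sgn)
    ultimately show ?thesis
      using False by (intro x)
  qed
qed

lemma zero_sum_orthogonal_basis:
  obtains B :: "(real^('a::finite option)) set" where "finite B" "card B = CARD('a)" "0 \<notin> B"
    "pairwise orthogonal B" "\<And>b. b \<in> B \<Longrightarrow> (\<Sum>i\<in>UNIV. b $ i) = 0"
proof -
  let ?V = "{b :: real^('a option). 1 \<bullet> b = 0}"
  have "(1 :: real^('a option)) \<noteq> 0" by (simp add: vec_eq_iff)
  then have "dim ?V = CARD('a)"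
    by (simp add: dim_hyperplane)
  moreover obtain B where "0 \<notin> B" "B \<subseteq> ?V" "pairwise orthogonal B" "independent B" "card B = dim ?V"
    using orthogonal_basis_subspace[OF subspace_hyperplane] by metis
  ultimately show ?thesis
    using that[of B] independent_bound[of B] by (auto simp: inner_vec_def)
qed

text \<open>
  Vectors of a nonzero orthogonal family are pairwise distinct, so counting the indices amounts
  to counting the vectors.
\<close>

lemma orthogonal_family:
  fixes f :: "'b \<Rightarrow> real^'a"
  assumes nz: "\<And>X. X \<in> T \<Longrightarrow> f X \<noteq> 0"
    and orth: "pairwise (\<lambda>X Y. orthogonal (f X) (f Y)) T"
  shows "inj_on f T" "pairwise orthogonal (f ` T)" "finite (f ` T)"
proof -
  show "inj_on f T"
  proof (rule inj_onI, rule ccontr)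
    fix X Y assume XY: "X \<in> T" "Y \<in> T" "f X = f Y" "X \<noteq> Y"
    then have "orthogonal (f X) (f X)"
      using orth by (metis pairwiseD)
    then show False
      using nz[OF XY(1)] by (simp add: orthogonal_self)
  qed
  show p: "pairwise orthogonal (f ` T)"
    using orth by (auto simp: pairwise_def)
  have "independent (f ` T)"
    using nz by (intro pairwise_orthogonal_independent[OF p]) auto
  then show "finite (f ` T)"
    using independent_bound by blast
qed

text \<open>
  Lower bound: an orthogonal basis of the zero-sum hyperplane supplies \<open>n\<close> homogeneous vectors,
  orthogonal to every \<open>xvec s\<close>. Upper bound: the \<open>z\<close>-type vectors of an orthogonal set yield
  orthogonal vectors in the hyperplane, and the signs of the others form an orthogonal set of
  sign vectors, because positive rescaling preserves orthogonality.
\<close>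

lemma max_card_orthogonal_homogeneous:
  fixes lam :: real
  assumes lam: "lam \<noteq> 0"
    and max: "max_card_in (orthogonal_sign_sets :: (real^('n::{finite,linorder} option)) set set) k"
  shows "max_card_in (orthogonal_homogeneous_sets lam :: 'n coords set set) (CARD('n) + k)"
  unfolding max_card_in_def
proof (intro conjI ballI)
  obtain A :: "(real^('n option)) set" where A: "A \<in> orthogonal_sign_sets" "finite A" "card A = k"
    using max unfolding max_card_in_def by blast
  obtain B :: "(real^('n option)) set" where B: "finite B" "card B = CARD('n)" "0 \<notin> B"
    "pairwise orthogonal B" "\<And>b. b \<in> B \<Longrightarrow> (\<Sum>i\<in>UNIV. b $ i) = 0"
    using zero_sum_orthogonal_basis[where 'a = 'n] by blast
  have injx: "inj_on xvec A"
    by (rule inj_onI) (metis xvec_simps(1) vec_eq_iff)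
  have injz: "inj_on zvec B"
    by (rule inj_onI) (metis zc_zvec B(5) vec_eq_iff)
  have sign: "sign_vector s" if "s \<in> A" for s
    using A(1) that by (auto simp: orthogonal_sign_sets_def)
  have disj: "zvec ` B \<inter> xvec ` A = {}"
  proof -
    have "zvec b \<noteq> xvec s" if "s \<in> A" for b s
    proof
      assume "zvec b = xvec s"
      then have "zvec b $ Inl None = xvec s $ Inl None" by simp
      with sign[OF that] show False by (auto simp: sign_vector_def dest: spec[of _ None])
    qed
    then show ?thesis by auto
  qed
  have zz: "group_metric lam 0 (zvec b) (zvec b') = 0" if "b \<in> B" "b' \<in> B" "b \<noteq> b'" for b b'
    using that B(5) pairwiseD[OF B(4), of b b']
    by (simp add: group_metric_diag zc_zvec orthogonal_def inner_vec_def)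
  have xx: "group_metric lam 0 (xvec s) (xvec s') = 0" if "s \<in> A" "s' \<in> A" "s \<noteq> s'" for s s'
    using that A(1) pairwiseD[of orthogonal A s s']
    by (simp add: group_metric_diag orthogonal_sign_sets_def orthogonal_def inner_vec_def)
  have zx: "group_metric lam 0 (zvec b) (xvec s) = 0"
      "group_metric lam 0 (xvec s) (zvec b) = 0" for b s
    by (simp_all add: group_metric_diag)
  have "pairwise (\<lambda>X Y. group_metric lam 0 X Y = 0) (zvec ` B \<union> xvec ` A)"
  proof (intro pairwiseI)
    fix X Y
    assume "X \<in> zvec ` B \<union> xvec ` A" "Y \<in> zvec ` B \<union> xvec ` A" "X \<noteq> Y"
    then show "group_metric lam 0 X Y = 0"
      by (elim UnE imageE; hypsubst) (use zz xx zx in blast)+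
  qed
  moreover have "homogeneous_vector lam X" if "X \<in> zvec ` B \<union> xvec ` A" for X
    using that B(3,5) sign homogeneous_zvec[OF lam] homogeneous_xvec[OF lam] by auto
  moreover have "card (zvec ` B \<union> xvec ` A) = CARD('n) + k"
    using A B disj by (simp add: card_Un_disjoint card_image injx injz)
  ultimately show "\<exists>S\<in>orthogonal_homogeneous_sets lam. finite S \<and> card (S :: 'n coords set) = CARD('n) + k"
    using A(2) B(1)
    by (intro bexI[of _ "zvec ` B \<union> xvec ` A"]) (auto simp: orthogonal_homogeneous_sets_def)
next
  fix S :: "'n coords set"
  assume "S \<in> orthogonal_homogeneous_sets lam"
  then have hom: "\<And>X. X \<in> S \<Longrightarrow> homogeneous_vector lam X"
    and orth: "\<And>X Y. X \<in> S \<Longrightarrow> Y \<in> S \<Longrightarrow> X \<noteq> Y \<Longrightarrow> group_metric lam 0 X Y = 0"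
    by (auto simp: orthogonal_homogeneous_sets_def pairwise_def)
  define Z where "Z = {X\<in>S. \<forall>i. X $ Inl i = 0}"
  define f :: "'n coords \<Rightarrow> real^('n option)" where "f X = (\<chi> i. zc X i)" for X
  define h :: "'n coords \<Rightarrow> real^('n option)" where "h X = (\<chi> i. sgn (X $ Inl i))" for X
  have fnz: "f X \<noteq> 0" if "X \<in> Z" for X
    using that hom[of X] by (auto elim!: homogeneous_vector_cases[OF lam]
      simp: Z_def f_def vec_eq_iff sign_vector_def dest: spec[of _ None])
  have forth: "orthogonal (f X) (f Y)" if "X \<in> Z" "Y \<in> Z" "X \<noteq> Y" for X Y
    using that orth[of X Y] lam
    by (auto simp: Z_def f_def group_metric_diag orthogonal_def inner_vec_def)
  \<comment> \<open>Adding the normal vector \<open>1\<close> of the hyperplane lowers the bound from \<open>n + 1\<close> to \<open>n\<close>.\<close>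
  have f1: "orthogonal 1 (f X)" for X
    by (simp add: f_def orthogonal_def inner_vec_def sum_zc)
  have fZ: "inj_on f Z" "pairwise orthogonal (f ` Z)" "finite (f ` Z)"
    using orthogonal_family[of Z f] fnz forth by (auto simp: pairwise_def)
  have not1: "1 \<notin> f ` Z"
  proof
    assume "1 \<in> f ` Z"
    then have "orthogonal 1 (1 :: real^('n option))" using f1 by (metis imageE)
    then show False by (simp add: orthogonal_self)
  qed
  have "independent (insert 1 (f ` Z))"
    using fZ(2) fnz f1
    by (intro pairwise_orthogonal_independent) (auto simp: pairwise_insert orthogonal_commute)
  then have "card (insert 1 (f ` Z)) \<le> CARD('n) + 1"
    using independent_bound[of "insert 1 (f ` Z)"] by simp
  then have cZ: "card Z \<le> CARD('n)"
    using fZ not1 by (simp add: card_image)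
  have "finite Z"
    using fZ finite_imageD by blast
  have hX: "sign_vector (h X) \<and> (\<exists>c. c \<noteq> 0 \<and> (\<forall>i. X $ Inl i = c * h X $ i)) \<and> (\<forall>i. zc X i = 0)"
    if "X \<in> S - Z" for X
  proof -
    have "homogeneous_vector lam X" using hom that by auto
    from lam this show ?thesis
    proof (cases rule: homogeneous_vector_cases)
      case z
      then show ?thesis using that by (auto simp: Z_def)
    next
      case (x c s)
      have "sgn (s $ i) = s $ i" for i
        using x(3) by (auto simp: sign_vector_def dest: spec[of _ i])
      then have h: "h X = sgn c *\<^sub>R s"
        using x(4) by (simp add: h_def vec_eq_iff sgn_mult)
      have "sign_vector (h X)"
        using x(2,3) unfolding h by (auto simp: sign_vector_def sgn_if)
      moreover have "\<forall>i. X $ Inl i = \<bar>c\<bar> * h X $ i"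
        using x(2,4) by (simp add: h abs_mult_sgn flip: mult.assoc)
      ultimately show ?thesis
        using x(1,2) by (intro conjI exI[of _ "\<bar>c\<bar>"]) auto
    qed
  qed
  have horth: "orthogonal (h X) (h Y)" if XY: "X \<in> S - Z" "Y \<in> S - Z" "X \<noteq> Y" for X Y
  proof -
    obtain c d where c: "c \<noteq> 0" "\<And>i. X $ Inl i = c * h X $ i"
      and d: "d \<noteq> 0" "\<And>i. Y $ Inl i = d * h Y $ i"
      using hX[OF XY(1)] hX[OF XY(2)] by blast
    have "0 = group_metric lam 0 X Y"
      using orth[of X Y] XY by simp
    also have "\<dots> = c * d * (h X \<bullet> h Y)"
      using hX[OF XY(1)] 
      by (simp add: group_metric_diag c d inner_vec_def sum_distrib_left mult_ac)
    finally show ?thesis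
      using c(1) d(1) by (simp add: orthogonal_def)
  qed
  have hnz: "h X \<noteq> 0" if "X \<in> S - Z" for X
    using hX[OF that] sign_vector_nonzero by blast
  have hS: "inj_on h (S - Z)" "pairwise orthogonal (h ` (S - Z))" "finite (h ` (S - Z))"
    using orthogonal_family[of "S - Z" h, OF hnz pairwiseI[OF horth]] by blast+
  then have "h ` (S - Z) \<in> orthogonal_sign_sets"
    using hX by (auto simp: orthogonal_sign_sets_def)
  then have "card (S - Z) \<le> k"
    using max card_image[OF hS(1)] unfolding max_card_in_def by metis
  have "finite (S - Z)"
    using hS finite_imageD by blast
  moreover have S: "S = Z \<union> (S - Z)" by (auto simp: Z_def)
  ultimately show "finite S"
    using \<open>finite Z\<close> by (metis finite_Un)
  have "card S \<le> card Z + card (S - Z)"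
    by (subst S) (rule card_Un_le)
  then show "card S \<le> CARD('n) + k"
    using cZ \<open>card (S - Z) \<le> k\<close> by simp
qed

text \<open>
  Changing one sign of \<open>(1, \<dots>, 1)\<close> moves it by twice a coordinate vector, which gives the
  \<open>x\<close>-directions; the coordinate vectors of the \<open>z\<close>-directions are themselves homogeneous.
\<close>

lemma homogeneous_vectors_span:
  assumes lam: "lam \<noteq> 0"
  shows "span {X :: 'n::{finite,linorder} coords. homogeneous_vector lam X} = UNIV"
proof -
  let ?H = "{X :: 'n coords. homogeneous_vector lam X}"
  have "axis m 1 \<in> span ?H" for m
  proof (cases m)
    case (Inl i)
    let ?s = "\<chi> k. if k = i then - 1 else 1"
    have "xvec 1 \<in> ?H" "xvec ?s \<in> ?H"
      by (auto intro!: homogeneous_xvec[OF lam] simp: sign_vector_def)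
    then have "(1 / 2) *\<^sub>R (xvec 1 - xvec ?s) \<in> span ?H"
      by (intro span_scale span_diff span_base)
    moreover have "(1 / 2) *\<^sub>R (xvec 1 - xvec ?s) = axis m 1"
      by (auto simp: Inl vec_eq_iff split_sum_all axis_def)
    ultimately show ?thesis by simp
  next
    case (Inr j)
    have "axis m 1 \<noteq> (0 :: 'n coords)" by (simp add: axis_eq_0_iff)
    then have "homogeneous_vector lam (axis m 1)"
      unfolding homogeneous_vector_iff[OF lam] by (simp add: Inr axis_def)
    then show ?thesis by (simp add: span_base)
  qed
  then have "Basis \<subseteq> span ?H"
    by (auto simp: Basis_vec_def)
  then have "span Basis \<subseteq> span ?H"
    by (metis span_mono span_span)
  then show ?thesis
    by auto
qed

theorem theorem2p9:
  fixes lam :: real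
  assumes "lam \<noteq> 0"
  shows
    "(\<exists>B :: 'n::{finite,linorder} coords set.
        (\<forall>X\<in>B. homogeneous_vector lam X) \<and> independent B \<and> card B = 2 * CARD('n) + 1) \<and>
     (odd (CARD('n) + 1) \<longrightarrow>
        max_card_in (orthogonal_homogeneous_sets lam :: 'n coords set set) (CARD('n) + 1)) \<and>
     (even (CARD('n) + 1) \<and> \<not> 4 dvd (CARD('n) + 1) \<longrightarrow>
        max_card_in (orthogonal_homogeneous_sets lam :: 'n coords set set) (CARD('n) + 2)) \<and>
     (even (CARD('n) + 1) \<and> 4 dvd (CARD('n) + 1) \<and>
      (\<exists>H :: real^('n option)^('n option). hadamard_matrix H) \<longrightarrow>
        max_card_in (orthogonal_homogeneous_sets lam :: 'n coords set set) (2 * CARD('n) + 1))"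
proof (intro conjI impI)
  let ?H = "{X :: 'n coords. homogeneous_vector lam X}"
  obtain B where B: "B \<subseteq> ?H" "independent B" "card B = dim ?H"
    using basis_exists[of ?H] by metis
  have "dim ?H = dim (span ?H)" by simp
  also have "\<dots> = 2 * CARD('n) + 1"
    unfolding homogeneous_vectors_span[OF assms] by (simp add: dim_UNIV)
  finally show "\<exists>B :: 'n coords set.
      (\<forall>X\<in>B. homogeneous_vector lam X) \<and> independent B \<and> card B = 2 * CARD('n) + 1"
    using B by auto
next
  assume "odd (CARD('n) + 1)"
  then show "max_card_in (orthogonal_homogeneous_sets lam :: 'n coords set set) (CARD('n) + 1)"
    by (intro max_card_orthogonal_homogeneous[OF assms] max_card_signs_odd) simp
next
  assume "even (CARD('n) + 1) \<and> \<not> 4 dvd (CARD('n) + 1)"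
  then show "max_card_in (orthogonal_homogeneous_sets lam :: 'n coords set set) (CARD('n) + 2)"
    by (intro max_card_orthogonal_homogeneous[OF assms] max_card_signs_even) simp_all
next
  assume "even (CARD('n) + 1) \<and> 4 dvd (CARD('n) + 1) \<and>
      (\<exists>H :: real^('n option)^('n option). hadamard_matrix H)"
  then have "max_card_in (orthogonal_sign_sets :: (real^('n option)) set set) CARD('n option)"
    using max_card_signs_hadamard by blast
  from max_card_orthogonal_homogeneous[OF assms this]
  show "max_card_in (orthogonal_homogeneous_sets lam :: 'n coords set set) (2 * CARD('n) + 1)"
    by (simp add: mult_2)
qed

end
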